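(* Let $T$ be a Frobenius monad on a dagger category $\mathcal{C}$, and let $U\colon\mathcal{C}^T\to\mathcal{C}$ be the forgetful functor. Then the FEM-algebras form the largest full subcategory of $\mathcal{C}^T$ containing (the image of) $\mathcal{C}_T$ that carries a dagger commuting with $U$: that is, the full subcategory of FEM-algebras contains all free algebras $(T(A),\mu_A)$ and carries such a dagger, and every full subcategory of $\mathcal{C}^T$ containing all free algebras and carrying a dagger $\ddagger$ with $U(f^\ddagger)=U(f)^\dagger$ consists only of FEM-algebras.
   Context: A dagger category has an identity-on-objects contravariant functor $f\mapsto f^\dagger$ with $f^{\dagger\dagger}=f$. A Frobenius monad is a monad $(T,\mu,\eta)$ on $\mathcal{C}$ with $T(f^\dagger)=T(f)^\dagger$ for all $f$ and $T(\mu_A)\circ\mu^\dagger_{T(A)}=\mu_{T(A)}\circ T(\mu_A^\dagger)$ for all $A$. $\mathcal{C}^T$ is the category of Eilenberg–Moore algebras: objects $(A,a)$ with $a\colon T(A)\to A$, $a\circ T(a)=a\circ\mu_A$, $a\circ\eta_A=\mathrm{id}_A$; morphisms $f\colon(A,a)\to(B,b)$ are $f\colon A\to B$ with $b\circ T(f)=f\circ a$; $U(A,a)=A$, $U(f)=f$. The Kleisli category $\mathcal{C}_T$ is identified with the full subcategory of free algebras $(T(A),\mu_A)$. A FEM-algebra is an Eilenberg–Moore algebra $(A,a)$ with $\mu_A\circ T(a)^\dagger=T(a)\circ\mu_A^\dagger$. *)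

theory Defs
  imports Main
begin

record ('o, 'm) cat =
  Obj :: "'o set"
  Arr :: "'m set"
  Dom :: "'m \<Rightarrow> 'o"
  Cod :: "'m \<Rightarrow> 'o"
  Ident :: "'o \<Rightarrow> 'm"
  Comp :: "'m \<Rightarrow> 'm \<Rightarrow> 'm" (infixl \<open>\<cdot>\<index>\<close> 70)

definition Hom :: "('o, 'm) cat \<Rightarrow> 'o \<Rightarrow> 'o \<Rightarrow> 'm set" where
  "Hom C A B = {f \<in> Arr C. Dom C f = A \<and> Cod C f = B}"

locale category =
  fixes C :: "('o, 'm) cat" (structure)
  assumes Dom_Obj: "f \<in> Arr C \<Longrightarrow> Dom C f \<in> Obj C"
    and Cod_Obj: "f \<in> Arr C \<Longrightarrow> Cod C f \<in> Obj C"
    and Ident_Hom: "A \<in> Obj C \<Longrightarrow> Ident C A \<in> Hom C A A"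
    and Comp_Hom: "f \<in> Hom C A B \<Longrightarrow> g \<in> Hom C B D \<Longrightarrow> g \<cdot> f \<in> Hom C A D"
    and Comp_Ident: "f \<in> Hom C A B \<Longrightarrow> f \<cdot> Ident C A = f"
    and Ident_Comp: "f \<in> Hom C A B \<Longrightarrow> Ident C B \<cdot> f = f"
    and Comp_assoc: "f \<in> Hom C A B \<Longrightarrow> g \<in> Hom C B D \<Longrightarrow> h \<in> Hom C D E \<Longrightarrow>
      (h \<cdot> g) \<cdot> f = h \<cdot> (g \<cdot> f)"

locale dagger_category = category +
  fixes dag :: "'m \<Rightarrow> 'm"
  assumes dag_Hom: "f \<in> Hom C A B \<Longrightarrow> dag f \<in> Hom C B A"
    and dag_Ident: "A \<in> Obj C \<Longrightarrow> dag (Ident C A) = Ident C A"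
    and dag_Comp: "f \<in> Hom C A B \<Longrightarrow> g \<in> Hom C B D \<Longrightarrow> dag (g \<cdot> f) = dag f \<cdot> dag g"
    and dag_dag: "f \<in> Arr C \<Longrightarrow> dag (dag f) = f"

text \<open>A full subcategory is determined by its set of objects.\<close>

definition full_subcategory :: "('o, 'm) cat \<Rightarrow> 'o set \<Rightarrow> ('o, 'm) cat" where
  "full_subcategory C S =
     \<lparr>Obj = S, Arr = {f \<in> Arr C. Dom C f \<in> S \<and> Cod C f \<in> S},
      Dom = Dom C, Cod = Cod C, Ident = Ident C, Comp = Comp C\<rparr>"

record ('o, 'm, 'p, 'n) cfunctor =
  on_obj :: "'o \<Rightarrow> 'p"
  on_arr :: "'m \<Rightarrow> 'n"

locale is_functor = C: category C + D: category D
  for C :: "('o, 'm) cat" and D :: "('p, 'n) cat" +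
  fixes F :: "('o, 'm, 'p, 'n) cfunctor"
  assumes on_obj_Obj: "A \<in> Obj C \<Longrightarrow> on_obj F A \<in> Obj D"
    and on_arr_Hom: "f \<in> Hom C A B \<Longrightarrow> on_arr F f \<in> Hom D (on_obj F A) (on_obj F B)"
    and on_arr_Ident: "A \<in> Obj C \<Longrightarrow> on_arr F (Ident C A) = Ident D (on_obj F A)"
    and on_arr_Comp: "f \<in> Hom C A B \<Longrightarrow> g \<in> Hom C B E \<Longrightarrow>
      on_arr F (g \<cdot>\<^bsub>C\<^esub> f) = on_arr F g \<cdot>\<^bsub>D\<^esub> on_arr F f"

locale monad = is_functor C C T
  for C :: "('o, 'm) cat" (structure) and T :: "('o, 'm, 'o, 'm) cfunctor" +
  fixes \<mu> :: "'o \<Rightarrow> 'm" and \<eta> :: "'o \<Rightarrow> 'm"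
  assumes mu_Hom: "A \<in> Obj C \<Longrightarrow> \<mu> A \<in> Hom C (on_obj T (on_obj T A)) (on_obj T A)"
    and eta_Hom: "A \<in> Obj C \<Longrightarrow> \<eta> A \<in> Hom C A (on_obj T A)"
    and mu_natural: "f \<in> Hom C A B \<Longrightarrow> \<mu> B \<cdot> on_arr T (on_arr T f) = on_arr T f \<cdot> \<mu> A"
    and eta_natural: "f \<in> Hom C A B \<Longrightarrow> \<eta> B \<cdot> f = on_arr T f \<cdot> \<eta> A"
    and mu_assoc: "A \<in> Obj C \<Longrightarrow> \<mu> A \<cdot> on_arr T (\<mu> A) = \<mu> A \<cdot> \<mu> (on_obj T A)"
    and mu_eta: "A \<in> Obj C \<Longrightarrow> \<mu> A \<cdot> \<eta> (on_obj T A) = Ident C (on_obj T A)"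
    and mu_T_eta: "A \<in> Obj C \<Longrightarrow> \<mu> A \<cdot> on_arr T (\<eta> A) = Ident C (on_obj T A)"

locale frobenius_monad = monad C T \<mu> \<eta> + dagger_category C dag
  for C :: "('o, 'm) cat" (structure) and dag T \<mu> \<eta> +
  assumes T_dag: "f \<in> Arr C \<Longrightarrow> on_arr T (dag f) = dag (on_arr T f)"
    and frobenius: "A \<in> Obj C \<Longrightarrow>
      on_arr T (\<mu> A) \<cdot> dag (\<mu> (on_obj T A)) = \<mu> (on_obj T A) \<cdot> on_arr T (dag (\<mu> A))"

definition EM_algebras ::
  "('o, 'm) cat \<Rightarrow> ('o, 'm, 'o, 'm) cfunctor \<Rightarrow> ('o \<Rightarrow> 'm) \<Rightarrow> ('o \<Rightarrow> 'm) \<Rightarrow> ('o \<times> 'm) set" where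
  "EM_algebras C T \<mu> \<eta> = {(A, a). A \<in> Obj C \<and> a \<in> Hom C (on_obj T A) A \<and>
     a \<cdot>\<^bsub>C\<^esub> on_arr T a = a \<cdot>\<^bsub>C\<^esub> \<mu> A \<and> a \<cdot>\<^bsub>C\<^esub> \<eta> A = Ident C A}"

text \<open>An arrow of the Eilenberg--Moore category is a triple (source algebra, underlying arrow,
  target algebra), since the underlying arrow alone does not determine its source and target.\<close>

definition EM_category ::
  "('o, 'm) cat \<Rightarrow> ('o, 'm, 'o, 'm) cfunctor \<Rightarrow> ('o \<Rightarrow> 'm) \<Rightarrow> ('o \<Rightarrow> 'm) \<Rightarrow>
   ('o \<times> 'm, ('o \<times> 'm) \<times> 'm \<times> ('o \<times> 'm)) cat" where
  "EM_category C T \<mu> \<eta> =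
     \<lparr>Obj = EM_algebras C T \<mu> \<eta>,
      Arr = {((A, a), f, (B, b)) | A a f B b.
               (A, a) \<in> EM_algebras C T \<mu> \<eta> \<and> (B, b) \<in> EM_algebras C T \<mu> \<eta> \<and>
               f \<in> Hom C A B \<and> b \<cdot>\<^bsub>C\<^esub> on_arr T f = f \<cdot>\<^bsub>C\<^esub> a},
      Dom = (\<lambda>(X, f, Y). X),
      Cod = (\<lambda>(X, f, Y). Y),
      Ident = (\<lambda>X. (X, Ident C (fst X), X)),
      Comp = (\<lambda>(Y, g, Z) (X, f, Y'). (X, g \<cdot>\<^bsub>C\<^esub> f, Z))\<rparr>"

definition EM_forget :: "('o \<times> 'm, ('o \<times> 'm) \<times> 'm \<times> ('o \<times> 'm), 'o, 'm) cfunctor" where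
  "EM_forget = \<lparr>on_obj = (\<lambda>(A, a). A), on_arr = (\<lambda>(X, f, Y). f)\<rparr>"

definition free_algebras ::
  "('o, 'm) cat \<Rightarrow> ('o, 'm, 'o, 'm) cfunctor \<Rightarrow> ('o \<Rightarrow> 'm) \<Rightarrow> ('o \<times> 'm) set" where
  "free_algebras C T \<mu> = {(on_obj T A, \<mu> A) | A. A \<in> Obj C}"

definition FEM_algebras ::
  "('o, 'm) cat \<Rightarrow> ('m \<Rightarrow> 'm) \<Rightarrow> ('o, 'm, 'o, 'm) cfunctor \<Rightarrow> ('o \<Rightarrow> 'm) \<Rightarrow> ('o \<Rightarrow> 'm) \<Rightarrow>
   ('o \<times> 'm) set" where
  "FEM_algebras C dag T \<mu> \<eta> = {(A, a) \<in> EM_algebras C T \<mu> \<eta>.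
     \<mu> A \<cdot>\<^bsub>C\<^esub> dag (on_arr T a) = on_arr T a \<cdot>\<^bsub>C\<^esub> dag (\<mu> A)}"

definition carries_dagger_over ::
  "('p, 'n) cat \<Rightarrow> ('p, 'n, 'o, 'm) cfunctor \<Rightarrow> ('m \<Rightarrow> 'm) \<Rightarrow> bool" where
  "carries_dagger_over D U dag \<longleftrightarrow>
     (\<exists>ddag. dagger_category D ddag \<and> (\<forall>f \<in> Arr D. on_arr U (ddag f) = dag (on_arr U f)))"

lemma category_full_subcategory:
  assumes "category C" "S \<subseteq> Obj C"
  shows "category (full_subcategory C S)"
proof -
  interpret category C by fact
  show ?thesis
    using assms(2) Dom_Obj Cod_Obj Ident_Hom Comp_Hom Comp_Ident Ident_Comp Comp_assoc
    by unfold_locales (simp_all add: full_subcategory_def Hom_def subset_iff)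
qed

lemma Hom_EM:
  "F \<in> Hom (EM_category C T \<mu> \<eta>) X Y \<longleftrightarrow>
   (\<exists>A a f B b. F = ((A, a), f, (B, b)) \<and> X = (A, a) \<and> Y = (B, b) \<and>
      (A, a) \<in> EM_algebras C T \<mu> \<eta> \<and> (B, b) \<in> EM_algebras C T \<mu> \<eta> \<and>
      f \<in> Hom C A B \<and> b \<cdot>\<^bsub>C\<^esub> on_arr T f = f \<cdot>\<^bsub>C\<^esub> a)"
  unfolding Hom_def[of "EM_category C T \<mu> \<eta>"] by (auto simp: EM_category_def)

context monad
begin

lemma EM_comp:
  assumes "(A, a) \<in> EM_algebras C T \<mu> \<eta>" "(B, b) \<in> EM_algebras C T \<mu> \<eta>"
    "(D, d) \<in> EM_algebras C T \<mu> \<eta>" "f \<in> Hom C A B" "g \<in> Hom C B D"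
    "b \<cdot> on_arr T f = f \<cdot> a" "d \<cdot> on_arr T g = g \<cdot> b"
  shows "d \<cdot> on_arr T (g \<cdot> f) = (g \<cdot> f) \<cdot> a"
proof -
  have h: "a \<in> Hom C (on_obj T A) A" "b \<in> Hom C (on_obj T B) B" "d \<in> Hom C (on_obj T D) D"
    using assms by (auto simp: EM_algebras_def)
  note Tf = on_arr_Hom[OF assms(4)] and Tg = on_arr_Hom[OF assms(5)]
  have "d \<cdot> on_arr T (g \<cdot> f) = (d \<cdot> on_arr T g) \<cdot> on_arr T f"
    using on_arr_Comp[OF assms(4,5)] C.Comp_assoc[OF Tf Tg h(3)] by simp
  also have "\<dots> = g \<cdot> (b \<cdot> on_arr T f)"
    using C.Comp_assoc[OF Tf h(2) assms(5)] assms(7) by simp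
  also have "\<dots> = (g \<cdot> f) \<cdot> a"
    using C.Comp_assoc[OF h(1) assms(4,5)] assms(6) by simp
  finally show ?thesis .
qed

lemma category_EM: "category (EM_category C T \<mu> \<eta>)"
proof
  fix X assume "X \<in> Obj (EM_category C T \<mu> \<eta>)"
  then obtain A a where X: "X = (A, a)" "(A, a) \<in> EM_algebras C T \<mu> \<eta>"
    by (cases X) (auto simp: EM_category_def)
  then have "A \<in> Obj C" "a \<in> Hom C (on_obj T A) A" by (auto simp: EM_algebras_def)
  then have "a \<cdot> on_arr T (Ident C A) = Ident C A \<cdot> a" "Ident C A \<in> Hom C A A"
    using C.Comp_Ident C.Ident_Comp C.Ident_Hom on_arr_Ident by simp_all
  with X show "Ident (EM_category C T \<mu> \<eta>) X \<in> Hom (EM_category C T \<mu> \<eta>) X X"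
    unfolding Hom_EM by (auto simp: EM_category_def)
next
  fix F X Y G Z
  assume "F \<in> Hom (EM_category C T \<mu> \<eta>) X Y" "G \<in> Hom (EM_category C T \<mu> \<eta>) Y Z"
  then show "G \<cdot>\<^bsub>EM_category C T \<mu> \<eta>\<^esub> F \<in> Hom (EM_category C T \<mu> \<eta>) X Z"
    unfolding Hom_EM using EM_comp C.Comp_Hom
    by (clarsimp simp: EM_category_def)
next
  fix F X Y G Z H W
  assume "F \<in> Hom (EM_category C T \<mu> \<eta>) X Y" "G \<in> Hom (EM_category C T \<mu> \<eta>) Y Z"
    "H \<in> Hom (EM_category C T \<mu> \<eta>) Z W"
  then show "(H \<cdot>\<^bsub>EM_category C T \<mu> \<eta>\<^esub> G) \<cdot>\<^bsub>EM_category C T \<mu> \<eta>\<^esub> F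
      = H \<cdot>\<^bsub>EM_category C T \<mu> \<eta>\<^esub> (G \<cdot>\<^bsub>EM_category C T \<mu> \<eta>\<^esub> F)"
    unfolding Hom_EM using C.Comp_assoc by (clarsimp simp: EM_category_def)
qed (auto simp: Hom_EM, auto simp: EM_category_def C.Comp_Ident C.Ident_Comp)

lemma is_functor_EM_forget: "is_functor (EM_category C T \<mu> \<eta>) C EM_forget"
proof -
  interpret EM: category "EM_category C T \<mu> \<eta>" by (rule category_EM)
  show ?thesis
    by unfold_locales
      (auto simp: Hom_EM, auto simp: EM_category_def EM_forget_def EM_algebras_def)
qed

lemma free_algebras_EM: "free_algebras C T \<mu> \<subseteq> EM_algebras C T \<mu> \<eta>"
  using on_obj_Obj mu_Hom mu_assoc mu_eta by (auto simp: free_algebras_def EM_algebras_def)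

end

end

theory Submission
  imports Defs
begin

text \<open>
  For an algebra \<open>(A, a)\<close> the FEM law says that \<open>h = \<mu> \<circ> T(a\<^sup>\<dagger>)\<close> and \<open>h\<^sup>\<dagger> = T(a) \<circ> \<mu>\<^sup>\<dagger>\<close>
  coincide. The first form gives \<open>h \<circ> \<eta> = a\<^sup>\<dagger>\<close>; the second is natural in algebra morphisms
  because \<open>\<mu>\<^sup>\<dagger>\<close> is natural. Precomposing that naturality square with \<open>\<eta>\<close> yields
  \<open>b\<^sup>\<dagger> \<circ> f = T(f) \<circ> a\<^sup>\<dagger>\<close> for every morphism \<open>f\<close> from \<open>(A, a)\<close> to \<open>(B, b)\<close>, that is,
  \<open>f\<^sup>\<dagger>\<close> is again a morphism.
  Conversely, \<open>a\<close> is a morphism from the free algebra \<open>(T A, \<mu>)\<close> to \<open>(A, a)\<close>. If its dagger is a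
  morphism, then \<open>\<mu> \<circ> T(a\<^sup>\<dagger>) = a\<^sup>\<dagger> \<circ> a\<close>, which is self-adjoint; this is the FEM law.
\<close>

context frobenius_monad
begin

lemma FEM_algebras_EM: "FEM_algebras C dag T \<mu> \<eta> \<subseteq> EM_algebras C T \<mu> \<eta>"
  by (auto simp: FEM_algebras_def)

lemma T_dag_Hom: "f \<in> Hom C A B \<Longrightarrow> on_arr T (dag f) = dag (on_arr T f)"
  by (simp add: Hom_def T_dag)

lemma dag_dag_Hom: "f \<in> Hom C A B \<Longrightarrow> dag (dag f) = f"
  by (simp add: Hom_def dag_dag)

lemma Hom_Obj:
  assumes "f \<in> Hom C A B"
  shows "A \<in> Obj C" and "B \<in> Obj C"
  using assms C.Dom_Obj C.Cod_Obj by (auto simp: Hom_def)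

text \<open>With \<open>\<mu> A\<close> as structure map, the FEM law is the Frobenius law at
  \<open>A\<close> once the dagger is moved out of \<open>T\<close>.\<close>

lemma free_algebras_FEM: "free_algebras C T \<mu> \<subseteq> FEM_algebras C dag T \<mu> \<eta>"
  using free_algebras_EM frobenius T_dag_Hom[OF mu_Hom]
  by (auto simp: free_algebras_def FEM_algebras_def)

text \<open>This is the dagger of the naturality square of \<open>\<mu>\<close> at
  \<open>dag f\<close>; since \<open>T\<close> commutes with \<open>dag\<close>, the double daggers
  cancel.\<close>

lemma dag_mu_natural:
  assumes f: "f \<in> Hom C A B"
  shows "on_arr T (on_arr T f) \<cdot> dag (\<mu> A) = dag (\<mu> B) \<cdot> on_arr T f"
proof -
  note obj = Hom_Obj[OF f] and df = dag_Hom[OF f]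
  note Tdf = on_arr_Hom[OF df] and Tf = on_arr_Hom[OF f]
  have "dag (\<mu> A \<cdot> on_arr T (on_arr T (dag f))) = dag (on_arr T (dag f) \<cdot> \<mu> B)"
    using mu_natural[OF df] by simp
  then show ?thesis
    using dag_Comp[OF on_arr_Hom[OF Tdf] mu_Hom[OF obj(1)]] dag_Comp[OF mu_Hom[OF obj(2)] Tdf]
    by (simp add: T_dag_Hom[OF f] T_dag_Hom[OF Tf] dag_dag_Hom[OF Tf]
        dag_dag_Hom[OF on_arr_Hom[OF Tf]])
qed

text \<open>Naturality of \<open>\<eta>\<close> at \<open>dag a\<close> moves \<open>\<eta>\<close>
  next to \<open>\<mu> A\<close>, where the unit law cancels both.\<close>

lemma mu_T_dag_eta:
  assumes a: "a \<in> Hom C (on_obj T A) A"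
  shows "(\<mu> A \<cdot> on_arr T (dag a)) \<cdot> \<eta> A = dag a"
proof -
  note obj = Hom_Obj[OF a] and da = dag_Hom[OF a]
  have "(\<mu> A \<cdot> on_arr T (dag a)) \<cdot> \<eta> A = \<mu> A \<cdot> (on_arr T (dag a) \<cdot> \<eta> A)"
    by (rule C.Comp_assoc[OF eta_Hom[OF obj(2)] on_arr_Hom[OF da] mu_Hom[OF obj(2)]])
  also have "\<dots> = (\<mu> A \<cdot> \<eta> (on_obj T A)) \<cdot> dag a"
    using eta_natural[OF da] C.Comp_assoc[OF da eta_Hom[OF obj(1)] mu_Hom[OF obj(2)]] by simp
  also have "\<dots> = dag a"
    using mu_eta[OF obj(2)] C.Ident_Comp[OF da] by simp
  finally show ?thesis .
qed

text \<open>The naturality square of \<open>dag \<mu>\<close> at \<open>f\<close> is pasted with the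
  image under \<open>T\<close> of the square \<open>hom\<close>.\<close>

lemma T_dag_mu_natural:
  assumes a: "a \<in> Hom C (on_obj T A) A" and b: "b \<in> Hom C (on_obj T B) B"
    and f: "f \<in> Hom C A B" and hom: "b \<cdot> on_arr T f = f \<cdot> a"
  shows "(on_arr T b \<cdot> dag (\<mu> B)) \<cdot> on_arr T f = on_arr T f \<cdot> (on_arr T a \<cdot> dag (\<mu> A))"
proof -
  note obj = Hom_Obj[OF f]
  note Ta = on_arr_Hom[OF a] and Tb = on_arr_Hom[OF b] and Tf = on_arr_Hom[OF f]
  note dmA = dag_Hom[OF mu_Hom[OF obj(1)]] and dmB = dag_Hom[OF mu_Hom[OF obj(2)]]
  have "(on_arr T b \<cdot> dag (\<mu> B)) \<cdot> on_arr T f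
      = on_arr T b \<cdot> (on_arr T (on_arr T f) \<cdot> dag (\<mu> A))"
    using C.Comp_assoc[OF Tf dmB Tb] dag_mu_natural[OF f] by simp
  also have "\<dots> = on_arr T (b \<cdot> on_arr T f) \<cdot> dag (\<mu> A)"
    using C.Comp_assoc[OF dmA on_arr_Hom[OF Tf] Tb] on_arr_Comp[OF Tf b] by simp
  also have "\<dots> = on_arr T f \<cdot> (on_arr T a \<cdot> dag (\<mu> A))"
    using C.Comp_assoc[OF dmA Ta Tf] on_arr_Comp[OF a f] hom by simp
  finally show ?thesis .
qed

lemma FEM_dag_morphism:
  assumes A: "(A, a) \<in> FEM_algebras C dag T \<mu> \<eta>" and B: "(B, b) \<in> FEM_algebras C dag T \<mu> \<eta>"
    and f: "f \<in> Hom C A B" and hom: "b \<cdot> on_arr T f = f \<cdot> a"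
  shows "a \<cdot> on_arr T (dag f) = dag f \<cdot> b"
proof -
  have a: "a \<in> Hom C (on_obj T A) A" and b: "b \<in> Hom C (on_obj T B) B"
    using A B by (auto simp: FEM_algebras_def EM_algebras_def)
  \<comment> \<open>Both forms of \<open>h\<close> and \<open>k\<close> are kept: the one with
    \<open>\<mu>\<close> evaluates them on \<open>\<eta>\<close>, and the one with
    \<open>dag (\<mu> A)\<close> or \<open>dag (\<mu> B)\<close> moves them past
    \<open>on_arr T f\<close>. The FEM law makes the two forms equal.\<close>
  define h k where "h = \<mu> A \<cdot> on_arr T (dag a)" and "k = \<mu> B \<cdot> on_arr T (dag b)"
  have h: "h = on_arr T a \<cdot> dag (\<mu> A)" and k: "k = on_arr T b \<cdot> dag (\<mu> B)"
    using A B T_dag_Hom[OF a] T_dag_Hom[OF b] by (auto simp: FEM_algebras_def h_def k_def)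
  note obj = Hom_Obj[OF f] and Tf = on_arr_Hom[OF f]
  note eA = eta_Hom[OF obj(1)] and eB = eta_Hom[OF obj(2)]
  have hH: "h \<in> Hom C (on_obj T A) (on_obj T A)" and kH: "k \<in> Hom C (on_obj T B) (on_obj T B)"
    unfolding h_def k_def
    by (rule C.Comp_Hom[OF on_arr_Hom[OF dag_Hom] mu_Hom]; fact)+
  have "dag b \<cdot> f = k \<cdot> (\<eta> B \<cdot> f)"
    using mu_T_dag_eta[OF b] C.Comp_assoc[OF f eB kH] by (simp add: k_def)
  also have "\<dots> = (k \<cdot> on_arr T f) \<cdot> \<eta> A"
    using eta_natural[OF f] C.Comp_assoc[OF eA Tf kH] by simp
  also have "\<dots> = on_arr T f \<cdot> (h \<cdot> \<eta> A)"
    using T_dag_mu_natural[OF a b f hom] C.Comp_assoc[OF eA hH Tf] by (simp add: h k)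
  also have "\<dots> = on_arr T f \<cdot> dag a"
    using mu_T_dag_eta[OF a] by (simp add: h_def)
  finally have "dag (dag b \<cdot> f) = dag (on_arr T f \<cdot> dag a)" by simp
  then show ?thesis
    using dag_Comp[OF f dag_Hom[OF b]] dag_Comp[OF dag_Hom[OF a] Tf]
    by (simp add: T_dag_Hom[OF f] dag_dag_Hom[OF a] dag_dag_Hom[OF b])
qed

text \<open>Specialises \<open>Hom_EM\<close> to a full subcategory. It serves twice: for the
  FEM-algebras, and for an arbitrary competitor \<open>S\<close>.\<close>

lemma Hom_full_EM:
  assumes "S \<subseteq> EM_algebras C T \<mu> \<eta>"
  shows "F \<in> Hom (full_subcategory (EM_category C T \<mu> \<eta>) S) X Y \<longleftrightarrow>
    (\<exists>A a f B b. F = ((A, a), f, (B, b)) \<and> X = (A, a) \<and> Y = (B, b) \<and>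
      (A, a) \<in> S \<and> (B, b) \<in> S \<and> f \<in> Hom C A B \<and> b \<cdot> on_arr T f = f \<cdot> a)"
proof -
  have "F \<in> Hom (full_subcategory (EM_category C T \<mu> \<eta>) S) X Y \<longleftrightarrow>
      F \<in> Hom (EM_category C T \<mu> \<eta>) X Y \<and> X \<in> S \<and> Y \<in> S"
    by (auto simp: Hom_def full_subcategory_def)
  then show ?thesis using assms by (auto simp: Hom_EM)
qed

lemma FEM_carries_dagger:
  "carries_dagger_over
     (full_subcategory (EM_category C T \<mu> \<eta>) (FEM_algebras C dag T \<mu> \<eta>)) EM_forget dag"
proof -
  let ?D = "full_subcategory (EM_category C T \<mu> \<eta>) (FEM_algebras C dag T \<mu> \<eta>)"
  \<comment> \<open>Commuting with \<open>EM_forget\<close> forces the middle component; the two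
    algebras trade places.\<close>
  let ?ddag = "\<lambda>(X, f, Y). (Y, dag f, X)"
  note Hom_D = Hom_full_EM[OF FEM_algebras_EM]
  interpret D: category ?D
    using FEM_algebras_EM
    by (intro category_full_subcategory category_EM) (simp add: EM_category_def)
  have "dagger_category ?D ?ddag"
  proof
    \<comment> \<open>Only this axiom uses the FEM law, through \<open>FEM_dag_morphism\<close>; the
      other axioms are inherited from \<open>dag\<close> on \<open>C\<close>.\<close>
    show "?ddag F \<in> Hom ?D Y X" if "F \<in> Hom ?D X Y" for F X Y
      using that FEM_dag_morphism dag_Hom unfolding Hom_D by fastforce
    show "?ddag (Ident ?D X) = Ident ?D X" if "X \<in> Obj ?D" for X
      using that dag_Ident
      by (auto simp: full_subcategory_def EM_category_def FEM_algebras_def EM_algebras_def)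
    show "?ddag (G \<cdot>\<^bsub>?D\<^esub> F) = ?ddag F \<cdot>\<^bsub>?D\<^esub> ?ddag G"
      if "F \<in> Hom ?D X Y" "G \<in> Hom ?D Y Z" for F G X Y Z
      using that dag_Comp unfolding Hom_D
      by (auto simp: full_subcategory_def EM_category_def)
    show "?ddag (?ddag F) = F" if "F \<in> Arr ?D" for F
      using that dag_dag_Hom by (auto simp: full_subcategory_def EM_category_def)
  qed
  moreover have "\<forall>F \<in> Arr ?D. on_arr EM_forget (?ddag F) = dag (on_arr EM_forget F)"
    by (auto simp: EM_forget_def)
  ultimately show ?thesis unfolding carries_dagger_over_def by blast
qed

lemma carries_dagger_FEM:
  assumes S: "S \<subseteq> EM_algebras C T \<mu> \<eta>" and free: "free_algebras C T \<mu> \<subseteq> S"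
    and dagger: "carries_dagger_over (full_subcategory (EM_category C T \<mu> \<eta>) S) EM_forget dag"
  shows "S \<subseteq> FEM_algebras C dag T \<mu> \<eta>"
proof clarify
  fix A a assume Aa: "(A, a) \<in> S"
  then have EM: "(A, a) \<in> EM_algebras C T \<mu> \<eta>" and A: "A \<in> Obj C"
    and a: "a \<in> Hom C (on_obj T A) A" and assoc: "a \<cdot> on_arr T a = a \<cdot> \<mu> A"
    using S by (auto simp: EM_algebras_def)
  let ?D = "full_subcategory (EM_category C T \<mu> \<eta>) S"
  \<comment> \<open>The structure map as a morphism out of the free algebra on \<open>A\<close>: its
    morphism condition is the associativity law of \<open>a\<close>. It lies in \<open>?D\<close>
    because \<open>S\<close> contains the free algebras and the subcategory is full.\<close>
  let ?F = "((on_obj T A, \<mu> A), a, (A, a))"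
  obtain ddag where ddag: "dagger_category ?D ddag"
    and U: "\<And>F. F \<in> Arr ?D \<Longrightarrow> on_arr EM_forget (ddag F) = dag (on_arr EM_forget F)"
    using dagger unfolding carries_dagger_over_def by blast
  have "(on_obj T A, \<mu> A) \<in> S" using free A by (auto simp: free_algebras_def)
  then have F: "?F \<in> Hom ?D (on_obj T A, \<mu> A) (A, a)"
    using Aa a assoc unfolding Hom_full_EM[OF S] by simp
  then have "ddag ?F \<in> Hom ?D (A, a) (on_obj T A, \<mu> A)"
    by (rule dagger_category.dag_Hom[OF ddag])
  moreover have "on_arr EM_forget (ddag ?F) = dag a"
    using F U[of ?F] by (simp add: Hom_def EM_forget_def)
  \<comment> \<open>This is the morphism condition of \<open>ddag ?F\<close>, whose underlying arrow
    is \<open>dag a\<close>.\<close>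
  ultimately have eq: "\<mu> A \<cdot> on_arr T (dag a) = dag a \<cdot> a"
    unfolding Hom_full_EM[OF S] by (auto simp: EM_forget_def)
  \<comment> \<open>The other side of the FEM law is the dagger of the left side of
    \<open>eq\<close>, and \<open>dag a \<cdot> a\<close> is self-adjoint.\<close>
  have "on_arr T a \<cdot> dag (\<mu> A) = dag (\<mu> A \<cdot> on_arr T (dag a))"
    using dag_Comp[OF on_arr_Hom[OF dag_Hom[OF a]] mu_Hom[OF A]]
    by (simp add: T_dag_Hom[OF a] dag_dag_Hom[OF on_arr_Hom[OF a]])
  also have "\<dots> = dag a \<cdot> a"
    using dag_Comp[OF a dag_Hom[OF a]] by (simp add: eq dag_dag_Hom[OF a])
  finally show "(A, a) \<in> FEM_algebras C dag T \<mu> \<eta>"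
    using EM eq by (simp add: FEM_algebras_def T_dag_Hom[OF a])
qed

end

theorem theorem6p6:
  fixes C :: "('o, 'm) cat" and dag :: "'m \<Rightarrow> 'm"
    and T :: "('o, 'm, 'o, 'm) cfunctor" and \<mu> \<eta> :: "'o \<Rightarrow> 'm"
  assumes "dagger_category C dag" and "frobenius_monad C dag T \<mu> \<eta>"
  shows "FEM_algebras C dag T \<mu> \<eta> \<subseteq> Obj (EM_category C T \<mu> \<eta>) \<and>
    free_algebras C T \<mu> \<subseteq> FEM_algebras C dag T \<mu> \<eta> \<and>
    carries_dagger_over
      (full_subcategory (EM_category C T \<mu> \<eta>) (FEM_algebras C dag T \<mu> \<eta>)) EM_forget dag \<and>
    (\<forall>S. S \<subseteq> Obj (EM_category C T \<mu> \<eta>) \<and> free_algebras C T \<mu> \<subseteq> S \<and>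
      carries_dagger_over (full_subcategory (EM_category C T \<mu> \<eta>) S) EM_forget dag
      \<longrightarrow> S \<subseteq> FEM_algebras C dag T \<mu> \<eta>)"
proof -
  interpret frobenius_monad C dag T \<mu> \<eta> by fact
  have "Obj (EM_category C T \<mu> \<eta>) = EM_algebras C T \<mu> \<eta>" by (simp add: EM_category_def)
  then show ?thesis
    using FEM_algebras_EM free_algebras_FEM FEM_carries_dagger carries_dagger_FEM by simp
qed

end
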